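(* Let $f\in\mathcal C$ and $m\in\operatorname{M}(f)$. Then the set $\mathcal A(f,m)$ is a ratio-covariety, and $\Delta(f,m)$ is its minimum with respect to inclusion.
   Context: Notation: $\mathbb N=\{0,1,2,\dots\}$, $p\ge 1$, and $\Lambda=\{e_1,\dots,e_p\}$ is the canonical basis of $\mathbb N^p$; $\langle m\rangle=\{\lambda m\mid\lambda\in\mathbb N\}$. $\mathcal C\subseteq\mathbb N^p$ is a fixed non-negative integer cone (the set of points of $\mathbb N^p$ lying in a finitely generated rational convex cone), with at least $p$ extremal rays. A $\mathcal C$-semigroup is an infinite, finitely generated submonoid $S\subseteq\mathcal C$ of $\mathbb N^p$ such that the minimal integer cone containing $S$ is $\mathcal C$ and $\mathcal H(S)=\mathcal C\setminus S$ is finite. A monomial order $\preceq$ on $\mathbb N^p$ is fixed: a total order compatible with addition with $0\preceq x$ for all $x$; it is assumed that $\{x\in\mathcal C\mid x\preceq k\}$ is finite for every $k\in\mathcal C$. $\operatorname{Fb}(S)=\max_\preceq\mathcal H(S)$ (and $-\sum_i e_i$ if $\mathcal H(S)=\emptyset$), $\operatorname{N}(S)=\{x\in S\mid x\prec\operatorname{Fb}(S)\}$, $\operatorname{m}(S)=\min_\preceq(S\setminus\{0\})$, and the ratio is $\operatorname{r}(S)=\min_\preceq(S\setminus\langle\operatorname{m}(S)\rangle)$. A $\mathcal C$-semigroup $S$ is an $\mathcal A$-semigroup if for every $s\in S$ and $e\in\Lambda$ the set $\{s,s+e\}$ is not contained in $\operatorname{N}(S)$. $\mathcal A(f,m)$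 is the set of all $\mathcal A$-semigroups $S$ with $\operatorname{Fb}(S)=f$ and $\operatorname{m}(S)=m$. $\Delta(f)=\{0\}\cup\{x\in\mathcal C\mid x\succ f\}$, and, for $f,m\in\mathcal C$ with $f\notin\langle m\rangle$, $\Delta(f,m)=\langle m\rangle\cup\Delta(f)$. $\operatorname{M}(f)=\{m\in\mathcal C\setminus\{0\}\mid m\prec f,\text{ or there is no }z\in\mathcal C\text{ with }f\prec z\prec m\}$. A ratio-covariety is a non-empty family $\mathcal R$ of $\mathcal C$-semigroups such that: (i) there exists a minimal element in $\mathcal R$ with respect to inclusion, denoted $\min_\subseteq\mathcal R$; (ii) if $S,T\in\mathcal R$ then $S\cap T\in\mathcal R$; (iii) if $S\in\mathcal R\setminus\{\min_\subseteq\mathcal R\}$ then $S\setminus\{\operatorname{r}(S)\}\in\mathcal R$.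
   Formalization: The formal theorem assumes f ∉ ⟨m⟩ (needed for Δ(f,m) to be defined) and, if m ≺ f, that m is not a canonical basis vector; for m = e_i ≺ f every candidate S has {0, e_i} ⊆ N(S), so 𝒜(f,m) is empty and the claim fails. *)

theory Defs
  imports "HOL-Analysis.Analysis"
begin

text \<open>
  The monoid \<open>\<nat>\<^sup>p\<close> is the type \<open>nat ^ 'p\<close> with \<open>p = CARD('p) \<ge> 1\<close>. An order on it is a binary
  predicate \<open>le\<close>, since the type already carries the componentwise order.
\<close>

definition of_nat_vec :: "nat ^ 'p \<Rightarrow> 'a::semiring_1 ^ 'p" where
  "of_nat_vec x = (\<chi> i. of_nat (x $ i))"

definition unit_vecs :: "(nat ^ 'p) set" where
  "unit_vecs = range (\<lambda>i. axis i 1)"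

definition multiples :: "nat ^ 'p \<Rightarrow> (nat ^ 'p) set" where
  "multiples m = range (\<lambda>k::nat. k *s m)"


subsection \<open>Integer cones and submonoids\<close>

definition integer_cone :: "(nat ^ 'p) set \<Rightarrow> bool" where
  "integer_cone C \<longleftrightarrow>
     (\<exists>G :: (real ^ 'p) set. finite G \<and> (\<forall>g\<in>G. \<forall>i. g $ i \<in> \<rat>) \<and>
        C = {x. of_nat_vec x \<in> convex_cone hull G})"

text \<open>
  The cone spanned by \<open>C\<close> lies in the non-negative orthant, hence is pointed, so its
  one-dimensional faces are exactly its extremal rays.
\<close>

definition extremal_rays :: "(nat ^ 'p) set \<Rightarrow> (real ^ 'p) set set" where
  "extremal_rays C = {R. R edge_of (convex_cone hull (of_nat_vec ` C))}"

definition add_submonoid :: "(nat ^ 'p) set \<Rightarrow> bool" where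
  "add_submonoid S \<longleftrightarrow> 0 \<in> S \<and> (\<forall>x\<in>S. \<forall>y\<in>S. x + y \<in> S)"

definition fin_gen_submonoid :: "(nat ^ 'p) set \<Rightarrow> bool" where
  "fin_gen_submonoid S \<longleftrightarrow> (\<exists>A. finite A \<and> S = add_submonoid hull A)"

definition minimal_integer_cone :: "(nat ^ 'p) set \<Rightarrow> (nat ^ 'p) set \<Rightarrow> bool" where
  "minimal_integer_cone S C \<longleftrightarrow>
     integer_cone C \<and> S \<subseteq> C \<and> (\<forall>D. integer_cone D \<and> S \<subseteq> D \<longrightarrow> C \<subseteq> D)"

definition gaps :: "(nat ^ 'p) set \<Rightarrow> (nat ^ 'p) set \<Rightarrow> (nat ^ 'p) set" where
  "gaps C S = C - S"

definition C_semigroup :: "(nat ^ 'p) set \<Rightarrow> (nat ^ 'p) set \<Rightarrow> bool" where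
  "C_semigroup C S \<longleftrightarrow>
     S \<subseteq> C \<and> infinite S \<and> add_submonoid S \<and> fin_gen_submonoid S \<and>
     minimal_integer_cone S C \<and> finite (gaps C S)"


subsection \<open>Monomial orders\<close>

definition monomial_order :: "(nat ^ 'p \<Rightarrow> nat ^ 'p \<Rightarrow> bool) \<Rightarrow> bool" where
  "monomial_order le \<longleftrightarrow>
     reflp le \<and> transp le \<and> antisymp le \<and> totalp le \<and>
     (\<forall>x y z. le x y \<longrightarrow> le (x + z) (y + z)) \<and> (\<forall>x. le 0 x)"

definition strict :: "('a \<Rightarrow> 'a \<Rightarrow> bool) \<Rightarrow> 'a \<Rightarrow> 'a \<Rightarrow> bool" where
  "strict le x y \<longleftrightarrow> le x y \<and> x \<noteq> y"

definition min_wrt :: "('a \<Rightarrow> 'a \<Rightarrow> bool) \<Rightarrow> 'a set \<Rightarrow> 'a" where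
  "min_wrt le A = (THE x. x \<in> A \<and> (\<forall>y\<in>A. le x y))"

definition max_wrt :: "('a \<Rightarrow> 'a \<Rightarrow> bool) \<Rightarrow> 'a set \<Rightarrow> 'a" where
  "max_wrt le A = (THE x. x \<in> A \<and> (\<forall>y\<in>A. le y x))"

text \<open>
  The unique extension of a monomial order to a translation-invariant order on \<open>\<int>\<^sup>p\<close>. It is needed
  because the Frobenius element may be \<open>(-1, \<dots>, -1)\<close>: \<open>a\<close> and \<open>b\<close> are compared after
  translating both into \<open>\<nat>\<^sup>p\<close>.
\<close>

definition int_ext :: "(nat ^ 'p \<Rightarrow> nat ^ 'p \<Rightarrow> bool) \<Rightarrow> int ^ 'p \<Rightarrow> int ^ 'p \<Rightarrow> bool" where
  "int_ext le a b \<longleftrightarrow>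
     (\<exists>x y z. of_nat_vec x = a + of_nat_vec z \<and> of_nat_vec y = b + of_nat_vec z \<and> le x y)"


subsection \<open>Invariants of a semigroup\<close>

definition Fb :: "(nat ^ 'p \<Rightarrow> nat ^ 'p \<Rightarrow> bool) \<Rightarrow> (nat ^ 'p) set \<Rightarrow> (nat ^ 'p) set \<Rightarrow> int ^ 'p" where
  "Fb le C S =
     (if gaps C S = {} then - (\<Sum>i\<in>UNIV. axis i 1) else of_nat_vec (max_wrt le (gaps C S)))"

definition small_elems ::
  "(nat ^ 'p \<Rightarrow> nat ^ 'p \<Rightarrow> bool) \<Rightarrow> (nat ^ 'p) set \<Rightarrow> (nat ^ 'p) set \<Rightarrow> (nat ^ 'p) set" where
  "small_elems le C S = {x \<in> S. strict (int_ext le) (of_nat_vec x) (Fb le C S)}"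

definition mult :: "(nat ^ 'p \<Rightarrow> nat ^ 'p \<Rightarrow> bool) \<Rightarrow> (nat ^ 'p) set \<Rightarrow> nat ^ 'p" where
  "mult le S = min_wrt le (S - {0})"

definition ratio :: "(nat ^ 'p \<Rightarrow> nat ^ 'p \<Rightarrow> bool) \<Rightarrow> (nat ^ 'p) set \<Rightarrow> nat ^ 'p" where
  "ratio le S = min_wrt le (S - multiples (mult le S))"

definition A_semigroup ::
  "(nat ^ 'p \<Rightarrow> nat ^ 'p \<Rightarrow> bool) \<Rightarrow> (nat ^ 'p) set \<Rightarrow> (nat ^ 'p) set \<Rightarrow> bool" where
  "A_semigroup le C S \<longleftrightarrow>
     C_semigroup C S \<and> (\<forall>s\<in>S. \<forall>e\<in>unit_vecs. \<not> {s, s + e} \<subseteq> small_elems le C S)"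


subsection \<open>The families and sets attached to \<open>f\<close> and \<open>m\<close>\<close>

definition A_family ::
  "(nat ^ 'p \<Rightarrow> nat ^ 'p \<Rightarrow> bool) \<Rightarrow> (nat ^ 'p) set \<Rightarrow> nat ^ 'p \<Rightarrow> nat ^ 'p \<Rightarrow> (nat ^ 'p) set set" where
  "A_family le C f m = {S. A_semigroup le C S \<and> Fb le C S = of_nat_vec f \<and> mult le S = m}"

definition Delta1 ::
  "(nat ^ 'p \<Rightarrow> nat ^ 'p \<Rightarrow> bool) \<Rightarrow> (nat ^ 'p) set \<Rightarrow> nat ^ 'p \<Rightarrow> (nat ^ 'p) set" where
  "Delta1 le C f = {0} \<union> {x \<in> C. strict le f x}"

definition Delta2 ::
  "(nat ^ 'p \<Rightarrow> nat ^ 'p \<Rightarrow> bool) \<Rightarrow> (nat ^ 'p) set \<Rightarrow> nat ^ 'p \<Rightarrow> nat ^ 'p \<Rightarrow> (nat ^ 'p) set" where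
  "Delta2 le C f m = multiples m \<union> Delta1 le C f"

definition M_set ::
  "(nat ^ 'p \<Rightarrow> nat ^ 'p \<Rightarrow> bool) \<Rightarrow> (nat ^ 'p) set \<Rightarrow> nat ^ 'p \<Rightarrow> (nat ^ 'p) set" where
  "M_set le C f =
     {m \<in> C - {0}. strict le m f \<or> \<not> (\<exists>z\<in>C. strict le f z \<and> strict le z m)}"


subsection \<open>Ratio-covarieties\<close>

definition inclusion_min :: "'a set set \<Rightarrow> 'a set \<Rightarrow> bool" where
  "inclusion_min \<R> M \<longleftrightarrow> M \<in> \<R> \<and> (\<forall>T\<in>\<R>. M \<subseteq> T)"

definition ratio_covariety ::
  "(nat ^ 'p \<Rightarrow> nat ^ 'p \<Rightarrow> bool) \<Rightarrow> (nat ^ 'p) set \<Rightarrow> (nat ^ 'p) set set \<Rightarrow> bool" where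
  "ratio_covariety le C \<R> \<longleftrightarrow>
     \<R> \<noteq> {} \<and> (\<forall>S\<in>\<R>. C_semigroup C S) \<and>
     (\<exists>M. inclusion_min \<R> M) \<and>
     (\<forall>S\<in>\<R>. \<forall>T\<in>\<R>. S \<inter> T \<in> \<R>) \<and>
     (\<forall>S\<in>\<R>. \<not> inclusion_min \<R> S \<longrightarrow> S - {ratio le S} \<in> \<R>)"

end

theory Submission
  imports Defs
begin

text \<open>
  Finite generation and the minimality of the cone need no attention in the closure properties,
  because they are automatic: every submonoid \<open>S\<close> of \<open>C\<close> with finite complement is a
  \<open>C\<close>-semigroup (\<open>cofinite_submonoid_C_semigroup\<close>). The cone is minimal because a positive
  multiple of each point of \<open>C\<close> lies in \<open>S\<close>. Finite generation is a form of Gordan's lemma,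
  derived here from a Dickson property of \<open>C\<close> (\<open>integer_cone_dickson\<close>): an infinite subset of
  \<open>C\<close> contains a point \<open>x\<close> such that infinitely many of its points lie in \<open>x + C\<close>. If \<open>S\<close> had
  infinitely many irreducible elements, this would give infinitely many differences \<open>c \<in> C\<close> with
  \<open>x\<close> and \<open>x + c\<close> irreducible; all but finitely many such \<open>c\<close> are non-zero elements of \<open>S\<close>, and
  then \<open>x + c\<close> is reducible.

  What remains is order-theoretic (\<open>mem_A_family_iff\<close>): a cofinite submonoid \<open>S\<close> of \<open>C\<close> is in
  \<open>A(f,m)\<close> iff \<open>f\<close> is its greatest gap, \<open>m\<close> its least non-zero element, and no two elements
  \<open>s\<close>, \<open>s + e\<close> of \<open>S\<close> lie below \<open>f\<close>. With \<open>f\<close> fixed, the last condition passes to subsets.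

  \<^item> Every member contains \<open>\<langle>m\<rangle>\<close> and all points of \<open>C\<close> above \<open>f\<close>, so it contains \<open>\<Delta>(f,m)\<close>. And
    \<open>\<Delta>(f,m)\<close> is a member: its elements below \<open>f\<close> are multiples of \<open>m\<close>, and two multiples of \<open>m\<close>
    can differ by a unit vector only if \<open>m\<close> is that unit vector, which is excluded for \<open>m\<close>
    below \<open>f\<close>.
  \<^item> Intersections are unproblematic, since the gaps of \<open>S \<inter> T\<close> are the union of the gaps.
  \<^item> If \<open>S \<noteq> \<Delta>(f,m)\<close>, then \<open>S\<close> has an element below \<open>f\<close> that is not a multiple of \<open>m\<close>, so the
    ratio \<open>r\<close> is below \<open>f\<close>. A sum \<open>a + b = r\<close> of elements of \<open>S\<close> other than \<open>r\<close> has
    \<open>a\<close>, \<open>b\<close> below \<open>r\<close>, hence multiples of \<open>m\<close>, and then so is \<open>r\<close>: a contradiction. So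
    \<open>S - {r}\<close> is a submonoid, and it has one more gap, which is not the greatest one.
\<close>

section \<open>Dickson's lemma in an integer cone\<close>

lemma nat_seq_mono_subsequence:
  fixes s :: "nat \<Rightarrow> nat"
  shows "\<exists>\<phi> :: nat \<Rightarrow> nat. strict_mono \<phi> \<and> mono (s \<circ> \<phi>)"
proof -
  obtain \<psi> where \<psi>: "strict_mono \<psi>" "monoseq (\<lambda>n. s (\<psi> n))"
    using seq_monosub[of s] by blast
  consider (inc) "\<forall>m. \<forall>n\<ge>m. s (\<psi> m) \<le> s (\<psi> n)" | (dec) "\<forall>m. \<forall>n\<ge>m. s (\<psi> n) \<le> s (\<psi> m)"
    using \<psi>(2) unfolding monoseq_def by blast
  then show ?thesis
  proof cases
    case inc
    with \<psi>(1) show ?thesis by (intro exI[of _ \<psi>]) (simp add: mono_def)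
  next
    case dec
    \<comment> \<open>A decreasing sequence of naturals is constant from the index of its least value on.\<close>
    obtain n0 where n0: "\<And>n. s (\<psi> n0) \<le> s (\<psi> n)"
      using ex_has_least_nat[of "\<lambda>_. True" 0 "s \<circ> \<psi>"] by auto
    have "s (\<psi> (n0 + n)) = s (\<psi> n0)" for n
      using n0[of "n0 + n"] dec by (meson le_add1 order_antisym)
    moreover have "strict_mono (\<lambda>n. \<psi> (n0 + n))"
      using \<psi>(1) by (simp add: strict_mono_def)
    ultimately show ?thesis
      by (intro exI[of _ "\<lambda>n. \<psi> (n0 + n)"]) (simp add: mono_def)
  qed
qed

lemma dickson_subsequence:
  fixes h :: "nat \<Rightarrow> 'j \<Rightarrow> nat"
  assumes "finite J"
  shows "\<exists>\<phi> :: nat \<Rightarrow> nat. strict_mono \<phi> \<and> (\<forall>j\<in>J. mono (\<lambda>n. h (\<phi> n) j))"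
  using assms
proof (induction J)
  case empty
  show ?case using strict_mono_id by blast
next
  case (insert j J)
  then obtain \<phi> :: "nat \<Rightarrow> nat" where \<phi>: "strict_mono \<phi>" "\<forall>i\<in>J. mono (\<lambda>n. h (\<phi> n) i)" by blast
  obtain \<psi> :: "nat \<Rightarrow> nat" where \<psi>: "strict_mono \<psi>" "mono ((\<lambda>n. h (\<phi> n) j) \<circ> \<psi>)"
    using nat_seq_mono_subsequence by blast
  have "strict_mono (\<phi> \<circ> \<psi>)"
    using \<phi>(1) \<psi>(1) by (rule strict_mono_o)
  moreover have "mono (\<lambda>n. h ((\<phi> \<circ> \<psi>) n) i)" if "i \<in> insert j J" for i
    using that \<psi> \<phi>(2) strict_mono_mono[OF \<psi>(1)] by (auto simp: mono_def)
  ultimately show ?case by blast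
qed

text \<open>
  The points of \<open>A\<close> are compared only through \<open>h\<close>, so auxiliary coordinates can be attached to them.
\<close>

lemma dickson_infinite:
  fixes h :: "'a \<Rightarrow> 'j \<Rightarrow> nat"
  assumes "infinite A" "finite J"
  shows "\<exists>x\<in>A. infinite {y \<in> A. \<forall>j\<in>J. h x j \<le> h y j}"
proof -
  obtain s :: "nat \<Rightarrow> 'a" where s: "inj s" "range s \<subseteq> A"
    using infinite_countable_subset[OF assms(1)] by blast
  obtain \<phi> :: "nat \<Rightarrow> nat" where \<phi>: "strict_mono \<phi>" "\<forall>j\<in>J. mono (\<lambda>n. h (s (\<phi> n)) j)"
    using dickson_subsequence[OF assms(2), of "h \<circ> s"] by auto
  have "inj (s \<circ> \<phi>)"
    using s(1) \<phi>(1) by (intro inj_compose strict_mono_imp_inj_on)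
  then have "infinite (range (s \<circ> \<phi>))"
    using range_inj_infinite by blast
  moreover have "range (s \<circ> \<phi>) \<subseteq> {y \<in> A. \<forall>j\<in>J. h (s (\<phi> 0)) j \<le> h y j}"
    using s(2) \<phi>(2) by (auto simp: mono_def)
  ultimately show ?thesis
    using s(2) finite_subset by blast
qed

lemma of_nat_vec_nth [simp]: "of_nat_vec x $ i = of_nat (x $ i)"
  by (simp add: of_nat_vec_def)

lemma of_nat_vec_0 [simp]: "of_nat_vec 0 = 0"
  by (simp add: vec_eq_iff)

lemma of_nat_vec_add: "of_nat_vec (x + y) = of_nat_vec x + of_nat_vec y"
  by (simp add: vec_eq_iff)

lemma of_nat_vec_smult: "(of_nat_vec (k *s x) :: real ^ 'p) = real k *\<^sub>R of_nat_vec x"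
  by (simp add: vec_eq_iff)

lemma of_nat_vec_eq_iff [simp]:
  "(of_nat_vec x :: 'a::semiring_char_0 ^ 'p) = of_nat_vec y \<longleftrightarrow> x = y"
  by (simp add: vec_eq_iff)

lemma integer_cone_0: "integer_cone C \<Longrightarrow> 0 \<in> C"
  by (auto simp: integer_cone_def convex_cone_hull_contains_0)

lemma integer_cone_add: "integer_cone C \<Longrightarrow> x \<in> C \<Longrightarrow> y \<in> C \<Longrightarrow> x + y \<in> C"
  by (auto simp: integer_cone_def of_nat_vec_add convex_cone_hull_add)

lemma integer_cone_smult: "integer_cone C \<Longrightarrow> x \<in> C \<Longrightarrow> k *s x \<in> C"
  by (auto simp: integer_cone_def of_nat_vec_smult convex_cone_hull_mul)

text \<open>Integer cones are saturated, because the real cone is closed under division by \<open>k\<close>.\<close>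

lemma integer_cone_smult_cancel:
  assumes "integer_cone C" "k *s x \<in> C" "0 < k"
  shows "x \<in> C"
proof -
  have "of_nat_vec x \<in> convex_cone hull G"
    if "of_nat_vec (k *s x) \<in> convex_cone hull G" for G :: "(real ^ 'a) set"
    using convex_cone_hull_mul[OF that, of "1 / real k"] assms(3)
    by (simp add: of_nat_vec_smult)
  with assms(1,2) show ?thesis
    by (auto simp: integer_cone_def)
qed

lemma convex_cone_hull_sum:
  assumes "\<And>i. i \<in> I \<Longrightarrow> c i \<ge> 0" "\<And>i. i \<in> I \<Longrightarrow> g i \<in> G"
  shows "(\<Sum>i\<in>I. c i *\<^sub>R g i) \<in> convex_cone hull G"
  using assms
  by (induction I rule: infinite_finite_induct)
     (simp_all add: convex_cone_hull_contains_0 convex_cone_hull_add convex_cone_hull_mul hull_inc)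

lemma convex_cone_hull_finite_explicit:
  assumes "finite G" "x \<in> convex_cone hull G"
  shows "\<exists>c. (\<forall>g. 0 \<le> c g) \<and> x = (\<Sum>g\<in>G. c g *\<^sub>R g)"
proof (rule hull_induct[OF assms(2)])
  fix x assume "x \<in> G"
  have "(\<Sum>g\<in>G. (if g = x then 1 else 0) *\<^sub>R g) = (\<Sum>g\<in>G. if g = x then g else 0)"
    by (intro sum.cong) auto
  also have "\<dots> = x"
    using \<open>x \<in> G\<close> assms(1) by simp
  finally show "\<exists>c. (\<forall>g. 0 \<le> c g) \<and> x = (\<Sum>g\<in>G. c g *\<^sub>R g)"
    by (intro exI[of _ "\<lambda>g. if g = x then 1 else 0"]) auto
next
  let ?K = "{x. \<exists>c. (\<forall>g. 0 \<le> c g) \<and> x = (\<Sum>g\<in>G. c g *\<^sub>R g)}"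
  have "0 \<in> ?K"
    by (intro CollectI exI[of _ "\<lambda>_. 0"]) simp
  moreover have "x + y \<in> ?K" if xy: "x \<in> ?K" "y \<in> ?K" for x y
  proof -
    obtain b c where "\<forall>g. 0 \<le> b g" "x = (\<Sum>g\<in>G. b g *\<^sub>R g)" "\<forall>g. 0 \<le> c g" "y = (\<Sum>g\<in>G. c g *\<^sub>R g)"
      using xy by blast
    then show ?thesis
      by (intro CollectI exI[of _ "\<lambda>g. b g + c g"]) (simp add: scaleR_left_distrib sum.distrib)
  qed
  moreover have "t *\<^sub>R x \<in> ?K" if x: "x \<in> ?K" and t: "0 \<le> t" for x t
  proof -
    obtain c where "\<forall>g. 0 \<le> c g" "x = (\<Sum>g\<in>G. c g *\<^sub>R g)"
      using x by blast
    with t show ?thesis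
      by (intro CollectI exI[of _ "\<lambda>g. t * c g"]) (simp add: scaleR_sum_right)
  qed
  ultimately show "convex_cone ?K"
    unfolding convex_cone_iff by blast
qed

lemma finite_rationals_common_denominator:
  assumes "finite Q" "Q \<subseteq> \<rat>"
  shows "\<exists>d>0. \<forall>q\<in>Q. real d * q \<in> \<int>"
  using assms
proof (induction Q)
  case empty
  show ?case by auto
next
  case (insert q Q)
  then obtain d where d: "d > 0" "\<forall>q\<in>Q. real d * q \<in> \<int>" by auto
  obtain a b :: int where ab: "b > 0" "q = of_int a / of_int b"
    using insert.prems by (auto elim: Rats_cases')
  have "real (d * nat b) * q' \<in> \<int>" if "q' \<in> insert q Q" for q'
  proof (cases "q' = q")
    case True
    then have "real (d * nat b) * q' = of_int (int d * a)"
      using ab by simp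
    then show ?thesis by (metis Ints_of_int)
  next
    case False
    then have "real d * q' \<in> \<int>" using d that by auto
    then have "of_int b * (real d * q') \<in> \<int>" using Ints_mult[OF Ints_of_int] by blast
    moreover have "real (d * nat b) * q' = of_int b * (real d * q')" using ab by simp
    ultimately show ?thesis by (simp only:)
  qed
  moreover have "d * nat b > 0" using d ab by simp
  ultimately show ?case by blast
qed

lemma finite_bounded_integer_vectors:
  fixes B :: "'p::finite \<Rightarrow> real"
  shows "finite {v :: real ^ 'p. \<forall>i. v $ i \<in> \<int> \<and> \<bar>v $ i\<bar> \<le> B i}"
proof (rule finite_subset)
  let ?Q = "\<lambda>i. {q \<in> \<int>. - B i \<le> q \<and> q \<le> B i}"
  show "{v :: real ^ 'p. \<forall>i. v $ i \<in> \<int> \<and> \<bar>v $ i\<bar> \<le> B i} \<subseteq> vec_lambda ` (PiE UNIV ?Q)"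
  proof
    fix v :: "real ^ 'p"
    assume "v \<in> {v. \<forall>i. v $ i \<in> \<int> \<and> \<bar>v $ i\<bar> \<le> B i}"
    then have "vec_nth v \<in> PiE UNIV ?Q" by (auto simp: abs_le_iff minus_le_iff)
    then show "v \<in> vec_lambda ` (PiE UNIV ?Q)"
      by (intro image_eqI[of _ _ "vec_nth v"]) (simp_all only: vec_nth_inverse)
  qed
  show "finite (vec_lambda ` (PiE UNIV ?Q) :: (real ^ 'p) set)"
    by (intro finite_imageI finite_PiE finite_int_segment) simp
qed

text \<open>
  Clear denominators so that \<open>d g\<close> is integral for each generator \<open>g\<close>, and write a point of \<open>C\<close>
  as \<open>x = \<Sum>g. n\<^sub>g d g + r\<close> with natural numbers \<open>n\<^sub>g\<close>, by rounding down the coefficients. The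
  remainder \<open>r\<close> is an integer vector in a bounded region, so it takes finitely many values, and on
  an infinite part of \<open>A\<close> it is constant. There, apply Dickson's lemma to the coordinates of \<open>x\<close>
  together with the coefficients \<open>n\<^sub>g\<close>: if all of them increase from \<open>x\<close> to \<open>y\<close>, the first group
  makes \<open>y - x\<close> a vector of natural numbers and the second puts it into the cone.

  The generators may have negative coordinates, so rounding need not stay in the orthant; this is
  why the coordinates of \<open>x\<close> are carried along.
\<close>

lemma integer_cone_dickson:
  fixes C :: "(nat ^ 'p::finite) set"
  assumes "integer_cone C" "A \<subseteq> C" "infinite A"
  shows "\<exists>x\<in>A. infinite {y \<in> A. \<exists>c\<in>C. y = x + c}"
proof -
  obtain G :: "(real ^ 'p) set" where G: "finite G" "\<forall>g\<in>G. \<forall>i. g $ i \<in> \<rat>"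
    and C: "C = {x. of_nat_vec x \<in> convex_cone hull G}"
    using assms(1) unfolding integer_cone_def by blast
  have "finite ((\<lambda>(g, i). g $ i) ` (G \<times> UNIV))"
    using G(1) by simp
  then obtain d where d: "d > 0" "\<And>g i. g \<in> G \<Longrightarrow> real d * g $ i \<in> \<int>"
    using finite_rationals_common_denominator[of "(\<lambda>(g, i). g $ i) ` (G \<times> UNIV)"] G(2)
    by fastforce
  have "\<forall>x\<in>C. \<exists>c. (\<forall>g. 0 \<le> c g) \<and> of_nat_vec x = (\<Sum>g\<in>G. c g *\<^sub>R g)"
    using convex_cone_hull_finite_explicit[OF G(1)] C by blast
  then obtain c where c: "\<And>x g. x \<in> C \<Longrightarrow> 0 \<le> c x g"
    "\<And>x. x \<in> C \<Longrightarrow> of_nat_vec x = (\<Sum>g\<in>G. c x g *\<^sub>R g)"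
    by metis
  define n where "n x g = nat \<lfloor>c x g / d\<rfloor>" for x g
  define r where "r x = of_nat_vec x - (\<Sum>g\<in>G. (real (n x g) * d) *\<^sub>R g)" for x
  define B where "B i = (\<Sum>g\<in>G. real d * \<bar>g $ i\<bar>)" for i
  have r_int: "r x $ i \<in> \<int>" for x i
    unfolding r_def
    by (simp add: mult.assoc del: of_nat_mult) (intro Ints_diff Ints_of_nat Ints_sum Ints_mult d(2))
  have r_bound: "\<bar>r x $ i\<bar> \<le> B i" if "x \<in> C" for x i
  proof -
    \<comment> \<open>Rounding \<open>c x g / d\<close> down changes the coefficient of \<open>g\<close> by at most \<open>d\<close>.\<close>
    have fl: "\<bar>c x g - real (n x g) * d\<bar> \<le> d" for g
    proof -
      let ?q = "c x g / d"
      have "real (n x g) = of_int \<lfloor>?q\<rfloor>"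
        using c(1)[OF that, of g] by (simp add: n_def)
      then have "0 \<le> ?q - real (n x g)" "?q - real (n x g) \<le> 1" by linarith+
      then show ?thesis using d(1) by (simp add: field_simps)
    qed
    have "r x = (\<Sum>g\<in>G. (c x g - real (n x g) * d) *\<^sub>R g)"
      by (simp add: r_def c(2)[OF that] scaleR_left_diff_distrib sum_subtractf)
    then have "\<bar>r x $ i\<bar> \<le> (\<Sum>g\<in>G. \<bar>(c x g - real (n x g) * d) * g $ i\<bar>)"
      by (simp add: sum_abs)
    also have "\<dots> \<le> B i"
      unfolding B_def abs_mult by (intro sum_mono mult_right_mono fl) auto
    finally show ?thesis .
  qed
  have "r ` A \<subseteq> {v. \<forall>i. v $ i \<in> \<int> \<and> \<bar>v $ i\<bar> \<le> B i}"
    using r_int r_bound assms(2) by blast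
  then have "finite (r ` A)"
    using finite_bounded_integer_vectors finite_subset by blast
  then obtain a where A': "infinite {x \<in> A. r x = r a}"
    using pigeonhole_infinite[OF assms(3)] by blast
  define h where "h x j = (case j of Inl i \<Rightarrow> x $ i | Inr g \<Rightarrow> n x g)" for x and j :: "'p + real ^ 'p"
  have "finite (range Inl \<union> Inr ` G :: ('p + real ^ 'p) set)"
    using G(1) by simp
  from dickson_infinite[OF A' this, of h] obtain x where x: "x \<in> A" "r x = r a"
    and inf: "infinite {y \<in> {x \<in> A. r x = r a}. \<forall>j\<in>range Inl \<union> Inr ` G. h x j \<le> h y j}"
    by blast
  have "{y \<in> {x \<in> A. r x = r a}. \<forall>j\<in>range Inl \<union> Inr ` G. h x j \<le> h y j}
      \<subseteq> {y \<in> A. \<exists>c\<in>C. y = x + c}"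
  proof clarify
    fix y assume y: "y \<in> A" "r y = r a" "\<forall>j\<in>range Inl \<union> Inr ` G. h x j \<le> h y j"
    then have le: "x $ i \<le> y $ i" and nle: "g \<in> G \<Longrightarrow> n x g \<le> n y g" for i g
      unfolding h_def by (auto simp: ball_Un)
    define z where "z = (\<chi> i. y $ i - x $ i)"
    have yz: "y = x + z"
      using le by (simp add: vec_eq_iff z_def)
    have "of_nat_vec z = of_nat_vec y - (of_nat_vec x :: real ^ 'p)"
      by (simp add: yz of_nat_vec_add)
    also have "\<dots> = (\<Sum>g\<in>G. ((real (n y g) - real (n x g)) * d) *\<^sub>R g)"
    proof -
      have "of_nat_vec v = r v + (\<Sum>g\<in>G. (real (n v g) * d) *\<^sub>R g)" for v
        by (simp add: r_def)
      then show ?thesis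
        using x(2) y(2) by (simp add: left_diff_distrib scaleR_left_diff_distrib sum_subtractf)
    qed
    also have "\<dots> \<in> convex_cone hull G"
      using nle by (intro convex_cone_hull_sum) auto
    finally have "z \<in> C" using C by blast
    with yz show "\<exists>c\<in>C. y = x + c" by blast
  qed
  with inf x(1) show ?thesis
    using finite_subset by blast
qed

section \<open>Cofinite submonoids\<close>

lemma add_submonoid_hull: "add_submonoid (add_submonoid hull A)"
  by (rule hull_in) (auto simp: add_submonoid_def)

lemma submonoid_smult: "add_submonoid S \<Longrightarrow> x \<in> S \<Longrightarrow> k *s x \<in> S"
proof (induction k)
  case 0
  then show ?case by (simp add: add_submonoid_def)
next
  case (Suc k)
  have "Suc k *s x = x + k *s x" by (simp add: vec_eq_iff)
  with Suc show ?case by (simp add: add_submonoid_def)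
qed

lemma submonoid_multiples_subset: "add_submonoid S \<Longrightarrow> x \<in> S \<Longrightarrow> multiples x \<subseteq> S"
  by (auto simp: multiples_def submonoid_smult)

definition irreducibles :: "(nat ^ 'p) set \<Rightarrow> (nat ^ 'p) set" where
  "irreducibles S = {x \<in> S - {0}. \<forall>a\<in>S - {0}. \<forall>b\<in>S - {0}. x \<noteq> a + b}"

text \<open>The coordinate sum strictly decreases when an element is split into two non-zero summands.\<close>

lemma submonoid_eq_hull_irreducibles:
  assumes "add_submonoid S"
  shows "S = add_submonoid hull (irreducibles S)"
proof
  show "add_submonoid hull (irreducibles S) \<subseteq> S"
    using assms by (intro hull_minimal) (auto simp: irreducibles_def)
  show "S \<subseteq> add_submonoid hull (irreducibles S)"
  proof
    fix x assume "x \<in> S"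
    then show "x \<in> add_submonoid hull (irreducibles S)"
    proof (induction "\<Sum>i\<in>UNIV. x $ i" arbitrary: x rule: less_induct)
      case less
      consider "x = 0" | "x \<in> irreducibles S" | a b where "a \<in> S - {0}" "b \<in> S - {0}" "x = a + b"
        using less.prems by (auto simp: irreducibles_def)
      then show ?case
      proof cases
        case 1
        then show ?thesis using add_submonoid_hull by (auto simp: add_submonoid_def)
      next
        case 2
        then show ?thesis by (rule hull_inc)
      next
        case 3
        have pos: "0 < (\<Sum>i\<in>UNIV. v $ i)" if "v \<noteq> 0" for v :: "nat ^ 'a"
          using that by (auto simp: vec_eq_iff intro!: sum_pos2)
        have "(\<Sum>i\<in>UNIV. x $ i) = (\<Sum>i\<in>UNIV. a $ i) + (\<Sum>i\<in>UNIV. b $ i)"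
          by (simp add: 3 sum.distrib)
        then have "a \<in> add_submonoid hull (irreducibles S)" "b \<in> add_submonoid hull (irreducibles S)"
          using 3 pos[of a] pos[of b] less.hyps by auto
        then show ?thesis
          using add_submonoid_hull 3(3) by (auto simp: add_submonoid_def)
      qed
    qed
  qed
qed

text \<open>
  The Dickson property yields differences in \<open>C\<close>, not in \<open>S\<close>. Cofiniteness bridges this: among
  infinitely many differences, one is a non-zero element of \<open>S\<close>.
\<close>

lemma finite_irreducibles:
  assumes "integer_cone C" "S \<subseteq> C" "finite (gaps C S)"
  shows "finite (irreducibles S)"
proof (rule ccontr)
  assume inf: "infinite (irreducibles S)"
  have "irreducibles S \<subseteq> C"
    using assms(2) by (auto simp: irreducibles_def)
  from integer_cone_dickson[OF assms(1) this inf]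
  obtain x where x: "x \<in> irreducibles S" "infinite {y \<in> irreducibles S. \<exists>c\<in>C. y = x + c}"
    by blast
  let ?D = "{c \<in> C. x + c \<in> irreducibles S}"
  have "{y \<in> irreducibles S. \<exists>c\<in>C. y = x + c} = (+) x ` ?D" by auto
  with x(2) have "infinite ((+) x ` ?D)" by simp
  then have "infinite ?D" by (rule contrapos_nn) (rule finite_imageI)
  moreover have "?D \<subseteq> gaps C S \<union> {0}"
    using x(1) by (auto simp: gaps_def irreducibles_def)
  ultimately show False
    using assms(3) finite_subset by blast
qed

lemma inj_smult_nat: "x \<noteq> 0 \<Longrightarrow> inj (\<lambda>k::nat. k *s x)"
  by (auto simp: inj_def vec_eq_iff)

lemma infinite_integer_cone:
  assumes "integer_cone C" "m \<in> C" "m \<noteq> 0"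
  shows "infinite C"
proof -
  have "infinite (range (\<lambda>k::nat. k *s m))"
    using inj_smult_nat[OF assms(3)] range_inj_infinite by blast
  moreover have "range (\<lambda>k::nat. k *s m) \<subseteq> C"
    using integer_cone_smult assms by blast
  ultimately show ?thesis using finite_subset by blast
qed

text \<open>
  The multiples of a non-zero point of \<open>C\<close> are pairwise distinct, so one of them avoids the finitely
  many gaps; a cone that contains this multiple contains the point.
\<close>

lemma cofinite_minimal_integer_cone:
  assumes "integer_cone C" "S \<subseteq> C" "add_submonoid S" "finite (gaps C S)"
  shows "minimal_integer_cone S C"
  unfolding minimal_integer_cone_def
proof (intro conjI allI impI subsetI)
  fix D x assume D: "integer_cone D \<and> S \<subseteq> D" and x: "x \<in> C"
  have "\<exists>k>0. k *s x \<in> S"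
  proof (cases "x = 0")
    case True
    then show ?thesis using assms(3) by (auto simp: add_submonoid_def)
  next
    case False
    have "infinite ((\<lambda>k::nat. k *s x) ` {0<..})"
      using inj_smult_nat[OF False] infinite_Ioi[of "0::nat"]
      by (metis finite_imageD inj_on_subset subset_UNIV)
    then have "\<not> (\<lambda>k::nat. k *s x) ` {0<..} \<subseteq> gaps C S"
      using assms(4) finite_subset by blast
    then show ?thesis
      using integer_cone_smult[OF assms(1) x] by (auto simp: gaps_def)
  qed
  then show "x \<in> D"
    using D integer_cone_smult_cancel by blast
qed (use assms in auto)

lemma cofinite_submonoid_C_semigroup:
  assumes "integer_cone C" "C \<noteq> {0}" "S \<subseteq> C" "add_submonoid S" "finite (gaps C S)"
  shows "C_semigroup C S"
proof -
  have "infinite C"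
    using assms(1,2) infinite_integer_cone integer_cone_0 by blast
  then have "infinite S"
    using assms(5) by (metis Diff_infinite_finite gaps_def)
  moreover have "fin_gen_submonoid S"
    unfolding fin_gen_submonoid_def
    using submonoid_eq_hull_irreducibles finite_irreducibles assms by blast
  ultimately show ?thesis
    using assms cofinite_minimal_integer_cone by (auto simp: C_semigroup_def)
qed

section \<open>Frobenius element, multiplicity and ratio\<close>

lemma finite_total_has_min:
  assumes "finite A" "A \<noteq> {}" "reflp le" "transp le" "totalp le"
  shows "\<exists>x\<in>A. \<forall>y\<in>A. le x y"
  using assms(1,2)
proof (induction A rule: finite_ne_induct)
  case (singleton x)
  then show ?case using assms(3) by (auto dest: reflpD)
next
  case (insert x F)
  then obtain y where y: "y \<in> F" "\<forall>z\<in>F. le y z" by blast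
  consider "le x y" | "le y x"
    using y(1) insert.hyps(3) totalpD[OF assms(5), of x y] by blast
  then show ?case
  proof cases
    case 1
    then have "\<forall>z\<in>insert x F. le x z"
      using y(2) reflpD[OF assms(3)] transpD[OF assms(4), of x y] by auto
    then show ?thesis by blast
  next
    case 2
    then show ?thesis using y by blast
  qed
qed

lemma min_wrt_eq:
  assumes "antisymp le" "x \<in> A" "\<And>y. y \<in> A \<Longrightarrow> le x y"
  shows "min_wrt le A = x"
  unfolding min_wrt_def using assms by (intro the_equality) (auto dest: antisympD)

lemma max_wrt_eq:
  assumes "antisymp le" "x \<in> A" "\<And>y. y \<in> A \<Longrightarrow> le y x"
  shows "max_wrt le A = x"
  unfolding max_wrt_def using assms by (intro the_equality) (auto dest: antisympD)

locale monomially_ordered_cone =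
  fixes C :: "(nat ^ 'p::finite) set"
    and le :: "nat ^ 'p \<Rightarrow> nat ^ 'p \<Rightarrow> bool"
  assumes cone: "integer_cone C"
    and monomial: "monomial_order le"
    and finite_below: "\<And>k. k \<in> C \<Longrightarrow> finite {x \<in> C. le x k}"
begin

lemma order_props:
  shows le_reflp: "reflp le" and le_transp: "transp le" and le_antisymp: "antisymp le" and le_totalp: "totalp le"
  using monomial by (auto simp: monomial_order_def)

lemma le_refl [simp]: "le x x"
  using le_reflp by (rule reflpD)

lemma le_trans: "le x y \<Longrightarrow> le y z \<Longrightarrow> le x z"
  using le_transp by (rule transpD)

lemma le_antisym: "le x y \<Longrightarrow> le y x \<Longrightarrow> x = y"
  using le_antisymp by (rule antisympD)

lemma le_total: "le x y \<or> le y x"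
  using totalpD[OF le_totalp] by (cases "x = y") auto

lemma le_zero [simp]: "le 0 x"
  using monomial by (auto simp: monomial_order_def)

lemma le_add_mono: "le x y \<Longrightarrow> le (x + z) (y + z)"
  using monomial by (simp add: monomial_order_def)

lemma le_add_cancel [simp]: "le (x + z) (y + z) \<longleftrightarrow> le x y"
proof
  assume *: "le (x + z) (y + z)"
  show "le x y"
  proof (rule ccontr)
    assume "\<not> le x y"
    then have "le (y + z) (x + z)"
      using le_total le_add_mono by blast
    with * have "x + z = y + z" by (rule le_antisym)
    then have "x = y" by simp
    with \<open>\<not> le x y\<close> show False by simp
  qed
next
qed (rule le_add_mono)

lemma le_add_left: "le x (y + x)"
  using le_add_cancel[of 0 x y] by simp

lemma le_add_right: "le x (x + y)"
  using le_add_left[of x y] by (simp add: add.commute)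

text \<open>
  A monomial order is cancellative because it is total, so on \<open>\<nat>\<^sup>p\<close> the extension to \<open>\<int>\<^sup>p\<close> is the
  order itself.
\<close>

lemma int_ext_of_nat_vec [simp]: "int_ext le (of_nat_vec x) (of_nat_vec y) \<longleftrightarrow> le x y"
proof
  assume "int_ext le (of_nat_vec x) (of_nat_vec y)"
  then obtain x' y' z where "(of_nat_vec x' :: int ^ 'p) = of_nat_vec (x + z)"
      "(of_nat_vec y' :: int ^ 'p) = of_nat_vec (y + z)" "le x' y'"
    unfolding int_ext_def of_nat_vec_add by blast
  then show "le x y" by simp
next
  assume "le x y"
  then show "int_ext le (of_nat_vec x) (of_nat_vec y)"
    unfolding int_ext_def by (intro exI[of _ x] exI[of _ y] exI[of _ 0]) simp
qed

lemma strict_int_ext_of_nat_vec [simp]: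
  "strict (int_ext le) (of_nat_vec x) (of_nat_vec y) \<longleftrightarrow> strict le x y"
  by (simp add: strict_def)

lemma strict_le_trans: "le x y \<Longrightarrow> strict le y z \<Longrightarrow> strict le x z"
  unfolding strict_def using le_trans le_antisym by blast

lemma not_le_iff_strict: "\<not> le x y \<longleftrightarrow> strict le y x"
  unfolding strict_def using le_total le_antisym by auto

text \<open>
  Finite initial segments make the order a well-order on \<open>C\<close>, so that the minima defining
  multiplicity and ratio exist.
\<close>

lemma has_min:
  assumes "A \<subseteq> C" "A \<noteq> {}"
  shows "\<exists>x\<in>A. \<forall>y\<in>A. le x y"
proof -
  obtain k where k: "k \<in> A" using assms(2) by blast
  have "finite {x \<in> A. le x k}"
    using k assms(1) by (intro finite_subset[OF _ finite_below[of k]]) auto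
  moreover have "k \<in> {x \<in> A. le x k}" using k by simp
  ultimately obtain x where "x \<in> A" "le x k" "\<forall>y\<in>{x \<in> A. le x k}. le x y"
    using finite_total_has_min[OF _ _ le_reflp le_transp le_totalp, of "{x \<in> A. le x k}"] by blast
  then have "\<forall>y\<in>A. le x y"
    using le_total le_trans by blast
  with \<open>x \<in> A\<close> show ?thesis by blast
qed

lemma min_wrt_iff:
  assumes "A \<subseteq> C" "A \<noteq> {}"
  shows "min_wrt le A = x \<longleftrightarrow> x \<in> A \<and> (\<forall>y\<in>A. le x y)"
proof
  obtain a where a: "a \<in> A" "\<forall>y\<in>A. le a y"
    using has_min[OF assms] by blast
  then have "min_wrt le A = a"
    using min_wrt_eq[OF le_antisymp] by blast
  then show "min_wrt le A = x \<Longrightarrow> x \<in> A \<and> (\<forall>y\<in>A. le x y)"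
    using a by simp
qed (use min_wrt_eq[OF le_antisymp] in blast)

lemma Fb_eq_iff:
  assumes "finite (gaps C S)"
  shows "Fb le C S = of_nat_vec f \<longleftrightarrow> f \<in> gaps C S \<and> (\<forall>x\<in>gaps C S. le x f)"
proof (cases "gaps C S = {}")
  case True
  \<comment> \<open>Then the Frobenius element has negative coordinates.\<close>
  have "- (\<Sum>i\<in>UNIV. axis i 1) \<noteq> (of_nat_vec f :: int ^ 'p)"
  proof
    assume eq: "- (\<Sum>i\<in>UNIV. axis i 1) = (of_nat_vec f :: int ^ 'p)"
    fix j :: 'p
    have "(\<Sum>i\<in>UNIV. axis i (1::int) $ j) = (\<Sum>i\<in>UNIV. if i = j then 1 else 0)"
      by (intro sum.cong) (auto simp: axis_def)
    with arg_cong[OF eq, of "\<lambda>v. v $ j"] show False by simp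
  qed
  with True show ?thesis by (simp add: Fb_def)
next
  case False
  have "reflp le\<inverse>\<inverse>" "transp le\<inverse>\<inverse>" "totalp le\<inverse>\<inverse>"
    using le_reflp le_transp le_totalp by (auto intro: reflpI dest: reflpD)
  with assms False have "\<exists>g\<in>gaps C S. \<forall>x\<in>gaps C S. le x g"
    using finite_total_has_min[of "gaps C S" "le\<inverse>\<inverse>"] by simp
  with False show ?thesis
    using max_wrt_eq[OF le_antisymp, of _ "gaps C S"] by (auto simp: Fb_def)
qed

lemma mult_eq_iff:
  assumes "S \<subseteq> C" "infinite S"
  shows "mult le S = m \<longleftrightarrow> m \<in> S - {0} \<and> (\<forall>x\<in>S - {0}. le m x)"
proof -
  have "S - {0} \<noteq> {}"
    using assms(2) by (metis finite.emptyI finite_Diff2 finite_insert)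
  then show ?thesis
    unfolding mult_def using assms(1) by (intro min_wrt_iff) auto
qed

text \<open>
  The working description of \<open>A(f,m)\<close>: cofiniteness replaces the conditions on generators and cones,
  and the integer vectors disappear.
\<close>

lemma mem_A_family_iff:
  assumes "C \<noteq> {0}"
  shows "S \<in> A_family le C f m \<longleftrightarrow>
    S \<subseteq> C \<and> add_submonoid S \<and> finite (C - S) \<and>
    f \<in> C - S \<and> (\<forall>x\<in>C - S. le x f) \<and>
    m \<in> S - {0} \<and> (\<forall>x\<in>S - {0}. le m x) \<and>
    (\<forall>s\<in>S. \<forall>e\<in>unit_vecs. s + e \<in> S \<longrightarrow> \<not> (strict le s f \<and> strict le (s + e) f))"
proof (cases "S \<subseteq> C \<and> add_submonoid S \<and> finite (C - S)")
  case True
  then have S: "C_semigroup C S"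
    using cofinite_submonoid_C_semigroup[OF cone assms] by (auto simp: gaps_def)
  then have inf: "infinite S" and fin: "finite (gaps C S)"
    by (auto simp: C_semigroup_def)
  have small: "{s, s + e} \<subseteq> small_elems le C S \<longleftrightarrow>
      s \<in> S \<and> s + e \<in> S \<and> strict le s f \<and> strict le (s + e) f"
    if "Fb le C S = of_nat_vec f" for s e
    using that by (auto simp: small_elems_def)
  have "S \<in> A_family le C f m \<longleftrightarrow>
      Fb le C S = of_nat_vec f \<and> mult le S = m \<and>
      (\<forall>s\<in>S. \<forall>e\<in>unit_vecs. \<not> {s, s + e} \<subseteq> small_elems le C S)"
    using S by (simp add: A_family_def A_semigroup_def conj_ac)
  also have "\<dots> \<longleftrightarrow> Fb le C S = of_nat_vec f \<and> mult le S = m \<and>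
      (\<forall>s\<in>S. \<forall>e\<in>unit_vecs. s + e \<in> S \<longrightarrow> \<not> (strict le s f \<and> strict le (s + e) f))"
    using small by (intro conj_cong refl ball_cong) auto
  finally show ?thesis
    using True by (simp only: Fb_eq_iff[OF fin] mult_eq_iff[OF _ inf] gaps_def simp_thms conj_assoc)
next
  case False
  then show ?thesis
    unfolding A_family_def A_semigroup_def C_semigroup_def gaps_def by blast
qed

text \<open>
  Summands of \<open>r\<close> are at most \<open>r\<close>. If they are elements of \<open>S\<close> different from \<open>r\<close>, minimality of
  \<open>r\<close> forces them into \<open>\<langle>m\<rangle>\<close>, which is closed under addition and does not contain \<open>r\<close>.
\<close>

lemma ratio_removal_submonoid:
  assumes S: "S \<subseteq> C" "add_submonoid S" and m: "m \<in> S"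
    and r: "r \<in> S - multiples m" "\<And>x. x \<in> S - multiples m \<Longrightarrow> le r x"
  shows "add_submonoid (S - {r})"
  unfolding add_submonoid_def
proof (intro conjI ballI)
  have mult_closed: "x + y \<in> multiples m" if "x \<in> multiples m" "y \<in> multiples m" for x y
    using that unfolding multiples_def by (auto simp flip: vector_sadd_rdistrib)
  have "0 \<in> multiples m"
    unfolding multiples_def by (metis rangeI vector_smult_lzero)
  with r(1) S(2) show "0 \<in> S - {r}"
    by (auto simp: add_submonoid_def)
  fix a b assume ab: "a \<in> S - {r}" "b \<in> S - {r}"
  have "a + b \<noteq> r"
  proof
    assume eq: "a + b = r"
    then have "le a r" "le b r"
      using le_add_right le_add_left by auto
    with ab r(2) have "a \<in> multiples m" "b \<in> multiples m"
      using le_antisym by blast+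
    with eq mult_closed r(1) show False by blast
  qed
  with ab S(2) show "a + b \<in> S - {r}"
    by (auto simp: add_submonoid_def)
qed

end

section \<open>The family as a ratio-covariety\<close>

locale A_family_parameters = monomially_ordered_cone +
  fixes f m :: "nat ^ 'a"
  assumes f_in: "f \<in> C"
    and m_in: "m \<in> M_set le C f"
    and f_not_multiple: "f \<notin> multiples m"
    and m_not_unit: "strict le m f \<Longrightarrow> m \<notin> unit_vecs"
begin

lemma m_nonzero: "m \<noteq> 0" and m_in_C: "m \<in> C"
  using m_in by (auto simp: M_set_def)

lemma C_nontrivial: "C \<noteq> {0}"
  using m_nonzero m_in_C by blast

lemmas mem_family = mem_A_family_iff[OF C_nontrivial]

lemma zero_multiple: "0 \<in> multiples m" and self_multiple: "m \<in> multiples m"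
  unfolding multiples_def
  by (metis rangeI vector_smult_lzero) (metis rangeI vector_smult_lid)

lemma nonzero_multipleD:
  assumes "x \<in> multiples m" "x \<noteq> 0"
  shows "\<exists>y. x = y + m"
proof -
  obtain k :: nat where k: "x = k *s m" using assms(1) by (auto simp: multiples_def)
  with assms(2) obtain l where "k = Suc l" by (cases k) auto
  with k have "x = l *s m + m" by (simp add: vec_eq_iff)
  then show ?thesis by blast
qed

lemma le_multiple: "x \<in> multiples m \<Longrightarrow> x \<noteq> 0 \<Longrightarrow> le m x"
  using nonzero_multipleD le_add_left by blast

text \<open>
  Here the second alternative in \<open>M(f)\<close> matters: if \<open>m\<close> is not below \<open>f\<close>, no point of \<open>C\<close> lies
  strictly between them.
\<close>

lemma m_le_above: "x \<in> C \<Longrightarrow> strict le f x \<Longrightarrow> le m x"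
  using m_in not_le_iff_strict le_trans unfolding M_set_def strict_def by blast

lemma mem_Delta: "x \<in> Delta2 le C f m \<longleftrightarrow> x \<in> multiples m \<or> x \<in> C \<and> strict le f x"
  using zero_multiple by (auto simp: Delta2_def Delta1_def)

text \<open>
  From \<open>l m = k m + e\<^sub>i\<close> follows \<open>(l - k) m = e\<^sub>i\<close>, which forces \<open>l - k = 1\<close>.
\<close>

lemma no_unit_step_in_multiples:
  assumes "x \<in> multiples m" "e \<in> unit_vecs" "x + e \<in> multiples m"
  shows "m \<in> unit_vecs"
proof -
  obtain i where i: "e = axis i 1" using assms(2) by (auto simp: unit_vecs_def)
  obtain k l :: nat where kl: "x = k *s m" "x + e = l *s m"
    using assms(1,3) by (auto simp: multiples_def)
  have eq: "l * m $ j = k * m $ j + (if j = i then 1 else 0)" for j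
    using arg_cong[OF kl(2)[symmetric], of "\<lambda>v. v $ j"] by (simp only: kl(1) i) (simp add: axis_def)
  have "(l - k) * m $ i = 1"
    using eq[of i] by (simp add: diff_mult_distrib)
  then have "l - k = 1" "m $ i = 1" by auto
  moreover from this have "m $ j = 0" if "j \<noteq> i" for j
    using eq[of j] that by auto
  ultimately have "m = axis i 1"
    by (auto simp: vec_eq_iff axis_def)
  then show ?thesis by (auto simp: unit_vecs_def)
qed

text \<open>
  A step by a unit vector below \<open>f\<close> would be a step inside \<open>\<langle>m\<rangle>\<close>, so \<open>m\<close> would be a unit vector;
  as the end of the step is a non-zero multiple of \<open>m\<close>, also \<open>m\<close> would be below \<open>f\<close>.
\<close>

lemma Delta_mem_family: "Delta2 le C f m \<in> A_family le C f m"
  unfolding mem_family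
proof (intro conjI ballI impI notI)
  let ?D = "Delta2 le C f m"
  have mult_C: "multiples m \<subseteq> C"
    using integer_cone_smult[OF cone m_in_C] by (auto simp: multiples_def)
  then show "?D \<subseteq> C" by (auto simp: mem_Delta)
  have "C - ?D \<subseteq> {x \<in> C. le x f}"
    using not_le_iff_strict[symmetric] by (auto simp: mem_Delta)
  then show "finite (C - ?D)" "\<And>x. x \<in> C - ?D \<Longrightarrow> le x f"
    using finite_below[OF f_in] finite_subset by blast+
  show "f \<in> C - ?D"
    using f_in f_not_multiple by (auto simp: mem_Delta strict_def)
  show "m \<in> ?D - {0}"
    using m_nonzero self_multiple by (auto simp: mem_Delta)
  show "le m x" if "x \<in> ?D - {0}" for x
    using that le_multiple m_le_above by (auto simp: mem_Delta)
  show "add_submonoid ?D"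
    unfolding add_submonoid_def
  proof (intro conjI ballI)
    show "0 \<in> ?D" using zero_multiple by (simp add: mem_Delta)
    have above: "x + y \<in> C \<and> strict le f (x + y)" if "x \<in> C" "strict le f x" "y \<in> C" for x y
      using that integer_cone_add[OF cone] le_add_right[of x y] le_trans le_antisym
      unfolding strict_def by blast
    fix x y assume xy: "x \<in> ?D" "y \<in> ?D"
    then have C: "x \<in> C" "y \<in> C" using \<open>?D \<subseteq> C\<close> by auto
    consider "x \<in> multiples m" "y \<in> multiples m" | "strict le f x" | "strict le f y"
      using xy by (auto simp: mem_Delta)
    then show "x + y \<in> ?D"
    proof cases
      case 1
      then show ?thesis
        unfolding mem_Delta multiples_def by (auto simp flip: vector_sadd_rdistrib)
    next
      case 2
      then show ?thesis using above C by (simp add: mem_Delta)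
    next
      case 3
      then show ?thesis using above[of y x] C by (simp add: mem_Delta add.commute)
    qed
  qed
  fix s e
  assume s: "s \<in> ?D" and e: "e \<in> unit_vecs" and se: "s + e \<in> ?D"
    and small: "strict le s f \<and> strict le (s + e) f"
  have below: "x \<in> multiples m" if "x \<in> ?D" "strict le x f" for x
    using that le_antisym by (auto simp: mem_Delta strict_def)
  then have "m \<in> unit_vecs"
    using no_unit_step_in_multiples s e se small by blast
  have "e \<noteq> 0" using e by (auto simp: unit_vecs_def vec_eq_iff axis_def)
  then have "s + e \<noteq> 0" by (auto simp: vec_eq_iff)
  then have "le m (s + e)"
    using below se small le_multiple by blast
  then have "strict le m f"
    using small strict_le_trans by blast
  with m_not_unit \<open>m \<in> unit_vecs\<close> show False by blast
qed

text \<open>Points above \<open>f\<close> cannot be gaps, since \<open>f\<close> is the greatest gap.\<close>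

lemma Delta_subset:
  assumes "S \<in> A_family le C f m"
  shows "Delta2 le C f m \<subseteq> S"
proof
  fix x assume "x \<in> Delta2 le C f m"
  then consider "x \<in> multiples m" | "x \<in> C" "\<not> le x f"
    using not_le_iff_strict by (auto simp: mem_Delta)
  then show "x \<in> S"
    using assms submonoid_multiples_subset[of S m] unfolding mem_family by cases auto
qed

lemma family_Int:
  assumes "S \<in> A_family le C f m" "T \<in> A_family le C f m"
  shows "S \<inter> T \<in> A_family le C f m"
proof -
  have "C - S \<inter> T = (C - S) \<union> (C - T)" by blast
  with assms show ?thesis
    unfolding mem_family add_submonoid_def by auto
qed

text \<open>
  An element of \<open>S\<close> outside \<open>\<Delta>(f,m)\<close> shows that the ratio is defined and lies below \<open>f\<close>, so that
  turning it into a gap keeps the Frobenius element.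
\<close>

lemma family_remove_ratio:
  assumes S: "S \<in> A_family le C f m" and "S \<noteq> Delta2 le C f m"
  shows "S - {ratio le S} \<in> A_family le C f m"
proof -
  let ?r = "ratio le S"
  have SC: "S \<subseteq> C" and sub: "add_submonoid S" and fS: "f \<notin> S" and mS: "m \<in> S"
    using S by (auto simp: mem_family)
  have "mult le S = m"
    using S by (simp add: A_family_def)
  moreover obtain x where x: "x \<in> S" "x \<notin> Delta2 le C f m"
    using assms Delta_subset by blast
  ultimately have r: "?r \<in> S - multiples m" "\<And>y. y \<in> S - multiples m \<Longrightarrow> le ?r y"
    using min_wrt_iff[of "S - multiples m" ?r] SC by (auto simp: ratio_def mem_Delta)
  have "le ?r x" "le x f"
    using x r SC not_le_iff_strict by (auto simp: mem_Delta)
  then have "le ?r f" by (rule le_trans)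
  have diff: "C - (S - {?r}) = insert ?r (C - S)"
    using r(1) SC by blast
  have "m \<noteq> ?r"
    using r(1) self_multiple by blast
  with S diff \<open>le ?r f\<close> fS show ?thesis
    using ratio_removal_submonoid[OF SC sub mS r] unfolding mem_family by auto
qed

lemma family_ratio_covariety:
  "ratio_covariety le C (A_family le C f m) \<and> inclusion_min (A_family le C f m) (Delta2 le C f m)"
proof
  show min: "inclusion_min (A_family le C f m) (Delta2 le C f m)"
    using Delta_mem_family Delta_subset by (auto simp: inclusion_min_def)
  show "ratio_covariety le C (A_family le C f m)"
    unfolding ratio_covariety_def
  proof (intro conjI ballI impI)
    show "A_family le C f m \<noteq> {}" "\<exists>M. inclusion_min (A_family le C f m) M"
      using Delta_mem_family min by blast+
    show "C_semigroup C S" if "S \<in> A_family le C f m" for S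
      using that by (simp add: A_family_def A_semigroup_def)
  qed (use family_Int family_remove_ratio min in auto)
qed

end

theorem proposition27:
  fixes C :: "(nat ^ 'p::finite) set"
    and le :: "nat ^ 'p \<Rightarrow> nat ^ 'p \<Rightarrow> bool"
    and f m :: "nat ^ 'p"
  assumes "integer_cone C"
    and "CARD('p) \<le> card (extremal_rays C)"
    and "monomial_order le"
    and "\<And>k. k \<in> C \<Longrightarrow> finite {x \<in> C. le x k}"
    and "f \<in> C"
    and "m \<in> M_set le C f"
    and "f \<notin> multiples m"
    and "strict le m f \<Longrightarrow> m \<notin> unit_vecs"
  shows "ratio_covariety le C (A_family le C f m) \<and>
         inclusion_min (A_family le C f m) (Delta2 le C f m)"
proof -
  interpret A_family_parameters C le f m
    using assms by unfold_locales auto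
  show ?thesis by (rule family_ratio_covariety)
qed

end
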